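(* Let $X_1,X_2,\dots$ be independent standard Cauchy random variables (location $0$, scale $1$) and let $N(t)$, $t>0$, be a homogeneous Poisson process with rate $\lambda>0$, independent of the $X_j$. Then for every $t>0$, $$[X_1;X_2,\dots,X_{N(t)}]\overset{d}{=}\sum_{j=1}^{F_{N(t)+1}}Y_{j,N(t)},$$ where the $Y_{j,N(t)}$ are (given $N(t)$) independent Cauchy random variables with location $0$ and scale parameter equal to $1/F_{N(t)}$, and $F_n$ are the Fibonacci numbers.
   Context: Fibonacci numbers: $F_1=F_2=1$, $F_{n+1}=F_n+F_{n-1}$. Continued fractions: $[X_1]=X_1$, and $[X_1;X_2,\dots,X_n]=X_1+1/[X_2;X_3,\dots,X_n]$ for $n\ge2$; $[X_1;X_2,\dots,X_{N(t)}]$ is the fraction with the random number $N(t)$ of levels. $\overset{d}{=}$ denotes equality in distribution.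
   Formalization: When N(t)=0, which has positive probability, the empty continued fraction and the scale 1/F_0=1/0 are undefined; there both sides are given the same arbitrary constant value, so the identity concerns the event N(t)≥1. *)

theory Defs
  imports "HOL-Probability.Probability" "HOL-Number_Theory.Fib"
begin

definition cauchy_density :: "real \<Rightarrow> real \<Rightarrow> real \<Rightarrow> real" where
  "cauchy_density l s x = 1 / (pi * s * (1 + ((x - l) / s)\<^sup>2))"

definition cauchy_distributed :: "'a measure \<Rightarrow> ('a \<Rightarrow> real) \<Rightarrow> real \<Rightarrow> real \<Rightarrow> bool" where
  "cauchy_distributed M X l s \<longleftrightarrow>
     0 < s \<and> distributed M lborel X (\<lambda>x. ennreal (cauchy_density l s x))"

(* There is no empty continued fraction. A vanishing denominator is read as 1 / 0 = 0;
   for random levels with a density this happens with probability zero. *)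
fun contfrac :: "real list \<Rightarrow> real" where
  "contfrac [x] = x"
| "contfrac (x # y # xs) = x + 1 / contfrac (y # xs)"

(* The increments are differences of naturals; since the paths are almost surely monotone,
   truncation matters only on a null set. *)
definition poisson_process :: "'a measure \<Rightarrow> real \<Rightarrow> (real \<Rightarrow> 'a \<Rightarrow> nat) \<Rightarrow> bool" where
  "poisson_process M rate N \<longleftrightarrow>
     prob_space M \<and>
     (\<forall>t\<ge>0. N t \<in> measurable M (count_space UNIV)) \<and>
     (AE \<omega> in M. N 0 \<omega> = 0 \<and> mono_on {0..} (\<lambda>t. N t \<omega>) \<and>
                 (\<forall>t\<ge>0. continuous (at_right t) (\<lambda>s. real (N s \<omega>)))) \<and>
     (\<forall>(n::nat) \<tau>. 0 \<le> \<tau> 0 \<and> mono_on {..n} \<tau> \<longrightarrow>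
        prob_space.indep_vars M (\<lambda>_. count_space UNIV)
          (\<lambda>i \<omega>. N (\<tau> (Suc i)) \<omega> - N (\<tau> i) \<omega>) {..<n}) \<and>
     (\<forall>s t. 0 \<le> s \<and> s < t \<longrightarrow>
        distr M (count_space UNIV) (\<lambda>\<omega>. N t \<omega> - N s \<omega>) =
          measure_pmf (poisson_pmf (rate * (t - s))))"

(* The sigma-algebras generated by the two families are independent; indep_var would
   force both families to take values in the same type. *)
definition indep_families ::
  "'a measure \<Rightarrow> 'i set \<Rightarrow> 'b measure \<Rightarrow> ('i \<Rightarrow> 'a \<Rightarrow> 'b) \<Rightarrow>
     'j set \<Rightarrow> 'c measure \<Rightarrow> ('j \<Rightarrow> 'a \<Rightarrow> 'c) \<Rightarrow> bool" where
  "indep_families M I B X J C N \<longleftrightarrow>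
     prob_space.indep_set M
       {(\<lambda>\<omega>. \<lambda>i\<in>I. X i \<omega>) -` A \<inter> space M | A. A \<in> sets (PiM I (\<lambda>_. B))}
       {(\<lambda>\<omega>. \<lambda>j\<in>J. N j \<omega>) -` A \<inter> space M | A. A \<in> sets (PiM J (\<lambda>_. C))}"

definition eq_in_distribution :: "'a measure \<Rightarrow> ('a \<Rightarrow> real) \<Rightarrow> ('a \<Rightarrow> real) \<Rightarrow> bool" where
  "eq_in_distribution M U V \<longleftrightarrow>
     U \<in> borel_measurable M \<and> V \<in> borel_measurable M \<and> distr M borel U = distr M borel V"

(* The conditional probability given the event E, as a measure on the same space. *)
abbreviation given :: "'a measure \<Rightarrow> ('a \<Rightarrow> bool) \<Rightarrow> 'a measure" where
  "given M E \<equiv> uniform_measure M {\<omega> \<in> space M. E \<omega>}"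

end

(* 1/Z is Cauchy with scale 1/s when Z is Cauchy with scale s, and scales of independent Cauchy
   variables add. So the scales s_n of the levels satisfy s_1 = 1 and s_(n+1) = 1 + 1/s_n, that is
   s_n = F_(n+1)/F_n, which is also the scale of a sum of F_(n+1) independent Cauchy variables
   with scale 1/F_n. It remains to condition on the value of N(t). *)
theory Submission
  imports Defs "HOL-Real_Asymp.Real_Asymp"
begin

section \<open>Fundamental theorem of calculus on half-lines and on the whole line\<close>

text \<open>The reflection of \<open>x\<close> to \<open>- x\<close> reduces this to the half-line
  \<open>{- a..}\<close> with antiderivative \<open>\<lambda>x. - F (- x)\<close>.\<close>

lemma nn_integral_FTC_atMost:
  fixes f :: "real \<Rightarrow> real"
  assumes [measurable]: "f \<in> borel_measurable borel"
    and deriv: "\<And>x. x \<le> a \<Longrightarrow> DERIV F x :> f x"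
    and nonneg: "\<And>x. x \<le> a \<Longrightarrow> 0 \<le> f x"
    and lim: "(F \<longlongrightarrow> T) at_bot"
  shows "(\<integral>\<^sup>+x. ennreal (f x) * indicator {..a} x \<partial>lborel) = F a - T"
proof -
  have "(\<integral>\<^sup>+x. ennreal (f x) * indicator {..a} x \<partial>lborel)
      = (\<integral>\<^sup>+x. ennreal (f (- x)) * indicator {- a..} x \<partial>lborel)"
    by (subst nn_integral_real_affine[where c="- 1" and t=0])
       (auto intro!: nn_integral_cong split: split_indicator)
  also have "\<dots> = ennreal (- T - (- F (- (- a))))"
  proof (rule nn_integral_FTC_atLeast[where F="\<lambda>x. - F (- x)"])
    fix x assume "- a \<le> x"
    then have "DERIV F (- x) :> f (- x)" by (intro deriv) simp
    then show "DERIV (\<lambda>x. - F (- x)) x :> f (- x)"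
      by (auto intro!: derivative_eq_intros DERIV_chain2[where f=F])
  next
    show "((\<lambda>x. - F (- x)) \<longlongrightarrow> - T) at_top"
      by (intro tendsto_minus filterlim_compose[OF lim filterlim_uminus_at_bot_at_top])
  qed (auto intro!: nonneg)
  finally show ?thesis by simp
qed

text \<open>Monotonicity of \<open>F\<close> gives \<open>A \<le> F 0\<close> and
  \<open>F 0 \<le> B\<close>, so the values \<open>F 0 - A\<close> and \<open>B - F 0\<close> over
  the two half-lines are nonnegative and add up in \<open>ennreal\<close>.\<close>

lemma nn_integral_FTC_UNIV:
  fixes f :: "real \<Rightarrow> real"
  assumes [measurable]: "f \<in> borel_measurable borel"
    and deriv: "\<And>x. DERIV F x :> f x"
    and nonneg: "\<And>x. 0 \<le> f x"
    and bot: "(F \<longlongrightarrow> A) at_bot" and top: "(F \<longlongrightarrow> B) at_top"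
  shows "(\<integral>\<^sup>+x. ennreal (f x) \<partial>lborel) = B - A"
proof -
  have mono: "F x \<le> F y" if "x \<le> y" for x y
    using that deriv nonneg by (intro DERIV_nonneg_imp_nondecreasing[of x y F]) auto
  have "A \<le> F 0"
    by (rule tendsto_upperbound[OF bot]) (auto intro!: eventually_mono[OF eventually_le_at_bot[of 0]] mono)
  moreover have "F 0 \<le> B"
    by (rule tendsto_lowerbound[OF top]) (auto intro!: eventually_mono[OF eventually_ge_at_top[of 0]] mono)
  moreover have "(\<integral>\<^sup>+x. ennreal (f x) \<partial>lborel)
      = (\<integral>\<^sup>+x. ennreal (f x) * indicator {..0} x + ennreal (f x) * indicator {0..} x \<partial>lborel)"
    \<comment> \<open>The two half-lines overlap only in the null set \<open>{0}\<close>.\<close>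
    by (intro nn_integral_cong_AE AE_I'[of "{0}"]) (auto split: split_indicator)
  ultimately show ?thesis
    using nn_integral_FTC_atMost[of f 0 F A] nn_integral_FTC_atLeast[of f 0 F B] assms
    by (simp add: nn_integral_add ennreal_plus[symmetric] del: ennreal_plus)
qed

section \<open>Density and distribution function of the centred Cauchy law\<close>

lemma measurable_cauchy_density [measurable]: "cauchy_density l s \<in> borel_measurable borel"
  unfolding cauchy_density_def[abs_def] by measurable

lemma cauchy_density_nonneg: "0 < s \<Longrightarrow> 0 \<le> cauchy_density l s x"
  unfolding cauchy_density_def by auto

lemma cauchy_density_0_eq: "0 < s \<Longrightarrow> cauchy_density 0 s x = s / (pi * (x\<^sup>2 + s\<^sup>2))"
proof -
  assume "0 < s"
  then have "1 + (x / s)\<^sup>2 = (x\<^sup>2 + s\<^sup>2) / s\<^sup>2"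
    by (simp add: power_divide add_divide_distrib)
  with \<open>0 < s\<close> show ?thesis
    unfolding cauchy_density_def by (simp add: power2_eq_square[of s])
qed

text \<open>The shift \<open>m\<close> is 0 for the distribution function and \<open>y\<close> for
  the shifted factor of a convolution.\<close>

lemma DERIV_arctan_scaled:
  fixes s :: real
  assumes "0 < s"
  shows "DERIV (\<lambda>x. arctan ((x - m) / s)) x :> s / ((x - m)\<^sup>2 + s\<^sup>2)"
proof -
  have "(x - m)\<^sup>2 + s\<^sup>2 > 0" using assms by (simp add: add_nonneg_pos)
  moreover have "1 + ((x - m) / s)\<^sup>2 > 0" by (simp add: add_pos_nonneg)
  ultimately show ?thesis
    using assms by (auto intro!: derivative_eq_intros simp: field_simps power2_eq_square)
qed

lemma DERIV_cauchy_cdf: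
  assumes "0 < s"
  shows "DERIV (\<lambda>x. arctan (x / s) / pi) x :> cauchy_density 0 s x"
  using DERIV_cdivide[OF DERIV_arctan_scaled[OF assms, of 0 x], of pi] assms
  by (simp add: cauchy_density_0_eq field_simps)

lemma tendsto_arctan_scaled:
  fixes s :: real
  assumes "0 < s"
  shows "((\<lambda>x. arctan ((x - m) / s)) \<longlongrightarrow> pi / 2) at_top"
    and "((\<lambda>x. arctan ((x - m) / s)) \<longlongrightarrow> - (pi / 2)) at_bot"
proof -
  have "filterlim (\<lambda>x. (x - m) / s) at_top at_top" "filterlim (\<lambda>x. (x - m) / s) at_bot at_bot"
    using assms by real_asymp+
  then show "((\<lambda>x. arctan ((x - m) / s)) \<longlongrightarrow> pi / 2) at_top"
    "((\<lambda>x. arctan ((x - m) / s)) \<longlongrightarrow> - (pi / 2)) at_bot"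
    by (auto intro: filterlim_compose[OF tendsto_arctan_at_top] filterlim_compose[OF tendsto_arctan_at_bot])
qed

lemma nn_integral_cauchy_atMost:
  assumes "0 < s"
  shows "(\<integral>\<^sup>+x. ennreal (cauchy_density 0 s x) * indicator {..a} x \<partial>lborel)
    = ennreal (1/2 + arctan (a / s) / pi)"
proof -
  have "((\<lambda>x. arctan (x / s) / pi) \<longlongrightarrow> - (pi / 2) / pi) at_bot"
    using tendsto_arctan_scaled(2)[OF assms, of 0] by (intro tendsto_divide) auto
  from nn_integral_FTC_atMost[OF _ DERIV_cauchy_cdf[OF assms] cauchy_density_nonneg[OF assms] this]
  show ?thesis by (simp add: algebra_simps)
qed

lemma nn_integral_cauchy_atLeast:
  assumes "0 < s"
  shows "(\<integral>\<^sup>+x. ennreal (cauchy_density 0 s x) * indicator {a..} x \<partial>lborel)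
    = ennreal (1/2 - arctan (a / s) / pi)"
proof -
  have "((\<lambda>x. arctan (x / s) / pi) \<longlongrightarrow> (pi / 2) / pi) at_top"
    using tendsto_arctan_scaled(1)[OF assms, of 0] by (intro tendsto_divide) auto
  from nn_integral_FTC_atLeast[OF _ DERIV_cauchy_cdf[OF assms] cauchy_density_nonneg[OF assms] this]
  show ?thesis by (simp add: algebra_simps)
qed

text \<open>These bounds make both tail probabilities positive, so that nothing is lost in passing
  from \<open>ennreal\<close> to \<open>real\<close>.\<close>

lemma arctan_over_pi_bounds: "- (1/2) < arctan x / pi" "arctan x / pi < 1/2"
  using arctan_bounded[of x] by (auto simp: field_simps)

lemma (in prob_space) cauchy_distributed_tails:
  assumes "cauchy_distributed M Z 0 s"
  shows "\<P>(\<omega> in M. Z \<omega> \<le> a) = 1/2 + arctan (a / s) / pi"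
    and "\<P>(\<omega> in M. a \<le> Z \<omega>) = 1/2 - arctan (a / s) / pi"
proof -
  from assms have s: "0 < s" and D: "distributed M lborel Z (\<lambda>x. ennreal (cauchy_density 0 s x))"
    by (auto simp: cauchy_distributed_def)
  have "emeasure M {\<omega> \<in> space M. Z \<omega> \<le> a} = ennreal (1/2 + arctan (a / s) / pi)"
    using distributed_emeasure[OF D, of "{..a}"] nn_integral_cauchy_atMost[OF s, of a]
    by (simp add: vimage_def Int_def conj_commute)
  moreover have "emeasure M {\<omega> \<in> space M. a \<le> Z \<omega>} = ennreal (1/2 - arctan (a / s) / pi)"
    using distributed_emeasure[OF D, of "{a..}"] nn_integral_cauchy_atLeast[OF s, of a]
    by (simp add: vimage_def Int_def conj_commute)
  ultimately show "\<P>(\<omega> in M. Z \<omega> \<le> a) = 1/2 + arctan (a / s) / pi"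
    "\<P>(\<omega> in M. a \<le> Z \<omega>) = 1/2 - arctan (a / s) / pi"
    using arctan_over_pi_bounds[of "a / s"] by (auto simp: measure_def)
qed

section \<open>Reciprocal of a Cauchy variable\<close>

text \<open>The event \<open>1 / Z \<omega> \<le> a\<close> is expressed by tails of
  \<open>Z\<close> at 0 and at \<open>1 / a\<close>. The formula for \<open>arctan\<close> of a
  reciprocal then yields the distribution function with scale \<open>1 / s\<close>.\<close>

lemma (in prob_space) cauchy_distributed_inverse:
  assumes Z: "cauchy_distributed M Z 0 s"
  shows "cauchy_distributed M (\<lambda>\<omega>. 1 / Z \<omega>) 0 (1 / s)"
proof -
  from Z have s: "0 < s" and [measurable]: "Z \<in> borel_measurable M"
    by (auto simp: cauchy_distributed_def distributed_def)
  have inv: "arctan (1 / (a * s)) = sgn a * pi / 2 - arctan (a * s)" if "a \<noteq> 0" for a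
    using Transcendental.arctan_inverse[of "a * s"] that s by (simp add: sgn_mult)
  note tails = cauchy_distributed_tails[OF Z]
  have cdf: "\<P>(\<omega> in M. 1 / Z \<omega> \<le> a) = 1/2 + arctan (a * s) / pi" for a
  proof -
    consider "a = 0" | "a > 0" | "a < 0" by linarith
    then show ?thesis
    proof cases
      case 1
      then show ?thesis using tails(1)[of 0] by simp
    next
      case 2
      \<comment> \<open>The point \<open>z = 0\<close> falls under the first alternative, because
        \<open>1 / 0 = 0\<close> lies below the positive \<open>a\<close>.\<close>
      have "1 / z \<le> a \<longleftrightarrow> z \<le> 0 \<or> 1 / a \<le> z" for z :: real
        using 2 mult_pos_neg[of a z] by (cases "z = 0"; cases "z < 0") (auto simp: field_simps)
      then have "\<P>(\<omega> in M. 1 / Z \<omega> \<le> a)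
          = prob ({\<omega>\<in>space M. Z \<omega> \<le> 0} \<union> {\<omega>\<in>space M. 1 / a \<le> Z \<omega>})"
        by (intro arg_cong[where f=prob]) auto
      also have "\<dots> = \<P>(\<omega> in M. Z \<omega> \<le> 0) + \<P>(\<omega> in M. 1 / a \<le> Z \<omega>)"
        using 2 by (intro finite_measure_Union)
          (auto dest: order_trans[of "1 / a" _ 0] simp: divide_le_0_iff)
      finally show ?thesis
        using 2 unfolding tails by (simp add: inv field_simps)
    next
      case 3
      have le: "1 / z \<le> a \<longleftrightarrow> z < 0 \<and> 1 / a \<le> z" for z :: real
        using 3 mult_nonpos_nonneg[of a z] by (cases "z = 0"; cases "z < 0") (auto simp: field_simps)
      have "1 / a < 0" using 3 by simp
      then have "1 / a \<le> z \<longleftrightarrow> 1 / z \<le> a \<or> 0 \<le> z" for z :: real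
        unfolding le by linarith
      \<comment> \<open>The wanted event is now a bounded interval for \<open>Z\<close>. Its
        probability is found as the difference of the upper tails at \<open>1 / a\<close> and at
        0.\<close>
      then have "\<P>(\<omega> in M. 1 / a \<le> Z \<omega>)
          = prob ({\<omega>\<in>space M. 1 / Z \<omega> \<le> a} \<union> {\<omega>\<in>space M. 0 \<le> Z \<omega>})"
        by (intro arg_cong[where f=prob]) blast
      also have "\<dots> = \<P>(\<omega> in M. 1 / Z \<omega> \<le> a) + \<P>(\<omega> in M. 0 \<le> Z \<omega>)"
        by (intro finite_measure_Union) (auto simp: le)
      finally show ?thesis
        using 3 unfolding tails by (simp add: inv field_simps)
    qed
  qed
  have "distributed M lborel (\<lambda>\<omega>. 1 / Z \<omega>) (\<lambda>x. ennreal (cauchy_density 0 (1 / s) x))"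
    using s cdf nn_integral_cauchy_atMost[of "1 / s"]
    by (intro distributedI_borel_atMost[where g="\<lambda>a. 1/2 + arctan (a * s) / pi"])
       (auto intro!: cauchy_density_nonneg simp: emeasure_eq_measure ennreal_mult'' ennreal_indicator)
  then show ?thesis using s by (simp add: cauchy_distributed_def)
qed

section \<open>Convolution of Cauchy densities\<close>

text \<open>Each numerator is a multiple of the derivative of its denominator plus a constant, so
  the terms integrate to logarithms and arctangents. \<open>D\<close> is the resultant of the two
  quadratics in \<open>x\<close>.\<close>

lemma cauchy_partial_fractions:
  fixes a b x y :: real
  assumes "0 < a" "0 < b" and D: "D = (y\<^sup>2 + b\<^sup>2 - a\<^sup>2)\<^sup>2 + 4 * y\<^sup>2 * a\<^sup>2" "D \<noteq> 0"
  shows "(y * (2 * x) + (y\<^sup>2 + b\<^sup>2 - a\<^sup>2)) / (x\<^sup>2 + a\<^sup>2)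
       + (- (y * (2 * (x - y))) + (y\<^sup>2 + a\<^sup>2 - b\<^sup>2)) / ((x - y)\<^sup>2 + b\<^sup>2)
       = D / ((x\<^sup>2 + a\<^sup>2) * ((x - y)\<^sup>2 + b\<^sup>2))"
proof -
  have "x\<^sup>2 + a\<^sup>2 \<noteq> 0" "(x - y)\<^sup>2 + b\<^sup>2 \<noteq> 0" using assms by (auto simp: sum_power2_eq_zero_iff)
  moreover have "(y * (2 * x) + (y\<^sup>2 + b\<^sup>2 - a\<^sup>2)) * ((x - y)\<^sup>2 + b\<^sup>2)
       + (- (y * (2 * (x - y))) + (y\<^sup>2 + a\<^sup>2 - b\<^sup>2)) * (x\<^sup>2 + a\<^sup>2) = D"
    unfolding D by algebra
  ultimately show ?thesis by (simp add: add_frac_eq)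
qed

text \<open>Each logarithm diverges, but the quotient of the two quadratics tends to 1.\<close>

lemma tendsto_ln_quotient:
  fixes a b y :: real
  assumes "0 < a" "0 < b"
  shows "((\<lambda>x. ln (x\<^sup>2 + a\<^sup>2) - ln ((x - y)\<^sup>2 + b\<^sup>2)) \<longlongrightarrow> 0) at_top"
    and "((\<lambda>x. ln (x\<^sup>2 + a\<^sup>2) - ln ((x - y)\<^sup>2 + b\<^sup>2)) \<longlongrightarrow> 0) at_bot"
  by real_asymp+

(* For y = 0 and a = b the two quadratics coincide and the partial fractions below break down;
   a single point does not matter for a density. *)
lemma cauchy_density_convolution:
  assumes a: "0 < a" and b: "0 < b" and y: "y \<noteq> 0"
  shows "(\<integral>\<^sup>+x. ennreal (cauchy_density 0 b (y - x)) * ennreal (cauchy_density 0 a x) \<partial>lborel)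
    = ennreal (cauchy_density 0 (a + b) y)"
proof -
  define D where "D = (y\<^sup>2 + b\<^sup>2 - a\<^sup>2)\<^sup>2 + 4 * y\<^sup>2 * a\<^sup>2"
  have D: "D > 0" unfolding D_def using a y by (intro add_nonneg_pos) auto
  \<comment> \<open>\<open>B\<close> and \<open>C\<close> cancel the factors \<open>a\<close> and
    \<open>b\<close> that arise from differentiating the arctangents. \<open>k\<close> is the
    constant \<open>a * b / pi\<^sup>2\<close> of the product of the densities, divided by the
    \<open>D\<close> of the partial fractions.\<close>
  define B C where "B = (y\<^sup>2 + b\<^sup>2 - a\<^sup>2) / a" and "C = (y\<^sup>2 + a\<^sup>2 - b\<^sup>2) / b"
  define k where "k = a * b / (pi\<^sup>2 * D)"
  \<comment> \<open>The antiderivative obtained by integrating the partial fractions term by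
    term.\<close>
  define F where "F x = k * (y * (ln (x\<^sup>2 + a\<^sup>2) - ln ((x - y)\<^sup>2 + b\<^sup>2))
      + B * arctan ((x - 0) / a) + C * arctan ((x - y) / b))" for x
  have dens: "cauchy_density 0 b (y - x) * cauchy_density 0 a x
      = k * (D / ((x\<^sup>2 + a\<^sup>2) * ((x - y)\<^sup>2 + b\<^sup>2)))" for x
    using a b D by (simp add: cauchy_density_0_eq k_def power2_commute[of y x] field_simps power2_eq_square)
  have "DERIV F x :> cauchy_density 0 b (y - x) * cauchy_density 0 a x" for x
  proof -
    have pos: "x\<^sup>2 + a\<^sup>2 > 0" "(x - y)\<^sup>2 + b\<^sup>2 > 0" using a b by (auto simp: add_nonneg_pos)
    have 1: "DERIV (\<lambda>x. ln (x\<^sup>2 + a\<^sup>2) - ln ((x - y)\<^sup>2 + b\<^sup>2)) x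
        :> 2 * x / (x\<^sup>2 + a\<^sup>2) - 2 * (x - y) / ((x - y)\<^sup>2 + b\<^sup>2)"
      using pos by (auto intro!: derivative_eq_intros)
    have "DERIV F x :> k * (y * (2 * x / (x\<^sup>2 + a\<^sup>2) - 2 * (x - y) / ((x - y)\<^sup>2 + b\<^sup>2))
        + B * (a / ((x - 0)\<^sup>2 + a\<^sup>2)) + C * (b / ((x - y)\<^sup>2 + b\<^sup>2)))"
      unfolding F_def
      by (intro DERIV_cmult DERIV_add 1 DERIV_arctan_scaled a b)
    also have "k * (y * (2 * x / (x\<^sup>2 + a\<^sup>2) - 2 * (x - y) / ((x - y)\<^sup>2 + b\<^sup>2))
        + B * (a / ((x - 0)\<^sup>2 + a\<^sup>2)) + C * (b / ((x - y)\<^sup>2 + b\<^sup>2))) = k * ((y * (2 * x) + (y\<^sup>2 + b\<^sup>2 - a\<^sup>2)) / (x\<^sup>2 + a\<^sup>2)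
       + (- (y * (2 * (x - y))) + (y\<^sup>2 + a\<^sup>2 - b\<^sup>2)) / ((x - y)\<^sup>2 + b\<^sup>2))"
    proof -
      have "B * (a / p) = (y\<^sup>2 + b\<^sup>2 - a\<^sup>2) / p" "C * (b / p) = (y\<^sup>2 + a\<^sup>2 - b\<^sup>2) / p" for p
        using a b by (simp_all add: B_def C_def)
      then show ?thesis by (simp add: add_divide_distrib diff_divide_distrib right_diff_distrib)
    qed
    also have "\<dots> = cauchy_density 0 b (y - x) * cauchy_density 0 a x"
      unfolding dens using cauchy_partial_fractions[OF a b D_def, of x] D by simp
    finally show ?thesis .
  qed
  \<comment> \<open>At both ends the logarithmic part vanishes, while each arctangent increases by
    \<open>pi\<close> in total.\<close>
  moreover have "(F \<longlongrightarrow> k * (y * 0 + B * (pi / 2) + C * (pi / 2))) at_top"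
    unfolding F_def by (intro tendsto_intros tendsto_ln_quotient tendsto_arctan_scaled a b)
  moreover have "(F \<longlongrightarrow> k * (y * 0 + B * - (pi / 2) + C * - (pi / 2))) at_bot"
    unfolding F_def by (intro tendsto_intros tendsto_ln_quotient tendsto_arctan_scaled a b)
  ultimately have "(\<integral>\<^sup>+x. ennreal (cauchy_density 0 b (y - x) * cauchy_density 0 a x) \<partial>lborel)
      = ennreal (k * (y * 0 + B * (pi / 2) + C * (pi / 2)) - k * (y * 0 + B * - (pi / 2) + C * - (pi / 2)))"
    using a b by (intro nn_integral_FTC_UNIV) (auto intro!: mult_nonneg_nonneg cauchy_density_nonneg)
  also have "k * (y * 0 + B * (pi / 2) + C * (pi / 2)) - k * (y * 0 + B * - (pi / 2) + C * - (pi / 2))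
      = k * pi * (B + C)"
    by (simp add: field_simps)
  also have "\<dots> = cauchy_density 0 (a + b) y"
  proof -
    \<comment> \<open>The factor \<open>y\<^sup>2 + (a - b)\<^sup>2\<close> occurs in both
      \<open>B + C\<close> and \<open>D\<close>. Cancelling it leaves the density of scale
      \<open>a + b\<close>.\<close>
    have 1: "b * (y\<^sup>2 + b\<^sup>2 - a\<^sup>2) + a * (y\<^sup>2 + a\<^sup>2 - b\<^sup>2) = (a + b) * (y\<^sup>2 + (a - b)\<^sup>2)"
      by algebra
    have 2: "D = (y\<^sup>2 + (a - b)\<^sup>2) * (y\<^sup>2 + (a + b)\<^sup>2)"
      unfolding D_def by algebra
    have "B + C = (a + b) * (y\<^sup>2 + (a - b)\<^sup>2) / (a * b)"
      using a b by (simp add: B_def C_def 1[symmetric] field_simps)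
    moreover have "y\<^sup>2 + (a - b)\<^sup>2 > 0" "y\<^sup>2 + (a + b)\<^sup>2 > 0" using y by (auto simp: add_pos_nonneg)
    ultimately show ?thesis
      using a b y unfolding k_def 2 by (simp add: cauchy_density_0_eq power2_eq_square[of pi])
  qed
  finally show ?thesis
    using a b by (simp add: ennreal_mult cauchy_density_nonneg)
qed

section \<open>Sums of independent Cauchy variables\<close>

text \<open>The density of the sum is the convolution, whose closed form is known away from 0.
  Densities that agree almost everywhere define the same law.\<close>

lemma (in prob_space) cauchy_distributed_add:
  assumes indep: "indep_var borel X borel Y"
    and X: "cauchy_distributed M X 0 a" and Y: "cauchy_distributed M Y 0 b"
  shows "cauchy_distributed M (\<lambda>\<omega>. X \<omega> + Y \<omega>) 0 (a + b)"
proof -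
  \<comment> \<open>The positivity of \<open>b\<close> comes first because
    \<open>cauchy_density_convolution\<close> is applied with the roles of \<open>a\<close> and
    \<open>b\<close> exchanged.\<close>
  from X Y have ab: "0 < b" "0 < a"
    and D: "distributed M lborel X (\<lambda>x. ennreal (cauchy_density 0 a x))"
           "distributed M lborel Y (\<lambda>x. ennreal (cauchy_density 0 b x))"
    by (auto simp: cauchy_distributed_def)
  have "AE z in lborel. (\<integral>\<^sup>+y. ennreal (cauchy_density 0 a (z - y)) * ennreal (cauchy_density 0 b y) \<partial>lborel)
      = ennreal (cauchy_density 0 (a + b) z)"
    using cauchy_density_convolution[OF ab] by (intro AE_I'[of "{0}"]) (auto simp: add.commute)
  with distributed_convolution[OF indep D]
  have "distributed M lborel (\<lambda>\<omega>. X \<omega> + Y \<omega>) (\<lambda>z. ennreal (cauchy_density 0 (a + b) z))"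
    by (subst distributed_cong_density[symmetric, rotated 2]) (auto simp: distributed_def)
  with ab show ?thesis by (simp add: cauchy_distributed_def)
qed

text \<open>The induction starts from a single variable, since an empty sum is constant and has no
  density.\<close>

lemma (in prob_space) cauchy_distributed_sum:
  assumes "finite I" "I \<noteq> {}" "indep_vars (\<lambda>_. borel) X I"
    and "\<And>i. i \<in> I \<Longrightarrow> cauchy_distributed M (X i) 0 s"
  shows "cauchy_distributed M (\<lambda>\<omega>. \<Sum>i\<in>I. X i \<omega>) 0 (real (card I) * s)"
  using assms
proof (induction rule: finite_ne_induct)
  case (insert i I)
  have "cauchy_distributed M (\<lambda>\<omega>. X i \<omega> + (\<Sum>i\<in>I. X i \<omega>)) 0 (s + real (card I) * s)"
    using insert by (intro cauchy_distributed_add indep_vars_sum insert) (auto intro: indep_vars_subset)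
  then show ?case using insert by (simp add: algebra_simps)
qed simp

section \<open>Continued fractions with Cauchy levels\<close>

lemma contfrac_Cons: "xs \<noteq> [] \<Longrightarrow> contfrac (x # xs) = x + 1 / contfrac xs"
  by (cases xs) auto

text \<open>An arbitrary family \<open>X\<close> covers both the random levels and the coordinate
  functions of a product space.\<close>

lemma measurable_contfrac:
  assumes "js \<noteq> []" "\<And>j. j \<in> set js \<Longrightarrow> X j \<in> borel_measurable M"
  shows "(\<lambda>\<omega>. contfrac (map (\<lambda>j. X j \<omega>) js)) \<in> borel_measurable M"
  using assms
proof (induction js rule: list_nonempty_induct)
  case (cons j js)
  then show ?case by (auto simp: contfrac_Cons intro!: borel_measurable_add borel_measurable_divide)
qed simp

text \<open>Induction on the list, splitting off the outermost level. Arbitrary lists of distinct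
  indices are allowed because the tail of 1, ..., n no longer starts at 1.\<close>

lemma (in prob_space) cauchy_distributed_contfrac:
  assumes indep: "indep_vars (\<lambda>_. borel) X I"
    and "\<And>j. j \<in> I \<Longrightarrow> cauchy_distributed M (X j) 0 1"
    and "js \<noteq> []" "distinct js" "set js \<subseteq> I"
  shows "cauchy_distributed M (\<lambda>\<omega>. contfrac (map (\<lambda>j. X j \<omega>) js)) 0
           (real (fib (length js + 1)) / real (fib (length js)))"
  using assms(3-)
proof (induction js rule: list_nonempty_induct)
  case (single j)
  with assms show ?case by simp
next
  case (cons j js)
  let ?c = "\<lambda>f. contfrac (map f js)"
  \<comment> \<open>Disjoint blocks of an independent family are independent. Both variables are
    therefore written as functions of the restrictions to \<open>{j}\<close> and to
    \<open>set js\<close>.\<close>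
  have "indep_var borel ((\<lambda>f. f j) \<circ> (\<lambda>\<omega>. restrict (\<lambda>i. X i \<omega>) {j}))
      borel ((\<lambda>f. 1 / ?c f) \<circ> (\<lambda>\<omega>. restrict (\<lambda>i. X i \<omega>) (set js)))"
    using cons by (intro indep_var_compose[OF indep_var_restrict[OF indep]] borel_measurable_divide
        measurable_contfrac measurable_component_singleton) auto
  also have "(\<lambda>f. f j) \<circ> (\<lambda>\<omega>. restrict (\<lambda>i. X i \<omega>) {j}) = X j"
    by auto
  also have "(\<lambda>f. 1 / ?c f) \<circ> (\<lambda>\<omega>. restrict (\<lambda>i. X i \<omega>) (set js)) = (\<lambda>\<omega>. 1 / ?c (\<lambda>j. X j \<omega>))"
    by (auto simp: fun_eq_iff cong: map_cong)
  finally have ind: "indep_var borel (X j) borel (\<lambda>\<omega>. 1 / ?c (\<lambda>j. X j \<omega>))" .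
  have "length js > 0" using cons by simp
  then have pos: "fib (length js) > 0" "fib (length js + 1) > 0" by (auto simp: fib_neq_0_nat)
  have "cauchy_distributed M (\<lambda>\<omega>. X j \<omega> + 1 / ?c (\<lambda>j. X j \<omega>)) 0
      (1 + 1 / (real (fib (length js + 1)) / real (fib (length js))))"
    using cons assms(2) by (intro cauchy_distributed_add ind cauchy_distributed_inverse) auto
  with pos cons show ?case by (simp add: contfrac_Cons field_simps)
qed

section \<open>Conditioning on the number of levels\<close>

text \<open>The events \<open>N \<omega> = n\<close> split the space into countably many pieces, and
  the law of a variable with random index is the sum of their contributions. Hence a comparison for
  each fixed \<open>n\<close> suffices.\<close>

lemma distr_mixture_cong:
  fixes N :: "'a \<Rightarrow> nat"
  assumes N [measurable]: "N \<in> measurable M (count_space UNIV)"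
    and U [measurable]: "\<And>n. U n \<in> measurable M K" and V [measurable]: "\<And>n. V n \<in> measurable M K"
    and eq: "\<And>n A. A \<in> sets K \<Longrightarrow>
      emeasure M {\<omega>\<in>space M. N \<omega> = n \<and> U n \<omega> \<in> A} = emeasure M {\<omega>\<in>space M. N \<omega> = n \<and> V n \<omega> \<in> A}"
  shows "distr M K (\<lambda>\<omega>. U (N \<omega>) \<omega>) = distr M K (\<lambda>\<omega>. V (N \<omega>) \<omega>)"
proof (rule measure_eqI)
  fix A assume "A \<in> sets (distr M K (\<lambda>\<omega>. U (N \<omega>) \<omega>))"
  then have A [measurable]: "A \<in> sets K" by simp
  have split: "emeasure (distr M K (\<lambda>\<omega>. W (N \<omega>) \<omega>)) A
      = (\<Sum>n. emeasure M {\<omega>\<in>space M. N \<omega> = n \<and> W n \<omega> \<in> A})"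
    if [measurable]: "\<And>n. W n \<in> measurable M K" for W
  proof -
    have "(\<lambda>\<omega>. W (N \<omega>) \<omega>) -` A \<inter> space M = (\<Union>n. {\<omega>\<in>space M. N \<omega> = n \<and> W n \<omega> \<in> A})"
      by auto
    moreover have "(\<Sum>n. emeasure M {\<omega>\<in>space M. N \<omega> = n \<and> W n \<omega> \<in> A})
        = emeasure M (\<Union>n. {\<omega>\<in>space M. N \<omega> = n \<and> W n \<omega> \<in> A})"
      by (intro suminf_emeasure) (auto simp: disjoint_family_on_def)
    ultimately show ?thesis by (simp add: emeasure_distr)
  qed
  show "emeasure (distr M K (\<lambda>\<omega>. U (N \<omega>) \<omega>)) A = emeasure (distr M K (\<lambda>\<omega>. V (N \<omega>) \<omega>)) A"
    by (simp add: split eq)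
qed simp

text \<open>On \<open>N t \<omega> = 0\<close> there is no fraction and no scale
  \<open>1 / real (fib 0)\<close>, so both sides take a common arbitrary value \<open>c\<close>
  there. Independence given \<open>N t\<close> is independence under each conditional measure with
  \<open>n \<ge> 1\<close>.\<close>

theorem mainTheorem15:
  fixes M :: "'a measure"
    and X :: "nat \<Rightarrow> 'a \<Rightarrow> real"
    and N :: "real \<Rightarrow> 'a \<Rightarrow> nat"
    and Y :: "nat \<Rightarrow> nat \<Rightarrow> 'a \<Rightarrow> real"
    and rate t c :: real
  assumes "prob_space M"
    and "prob_space.indep_vars M (\<lambda>_. borel) X {1..}"
    and "\<And>j. 1 \<le> j \<Longrightarrow> cauchy_distributed M (X j) 0 1"
    and "0 < rate"
    and "poisson_process M rate N"
    and "indep_families M {1..} borel X {0..} (count_space UNIV) N"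
    and "0 < t"
    and "\<And>n. 1 \<le> n \<Longrightarrow>
           prob_space.indep_vars (given M (\<lambda>\<omega>. N t \<omega> = n)) (\<lambda>_. borel)
             (\<lambda>j. Y j n) {1..fib (n + 1)}"
    and "\<And>n j. 1 \<le> n \<Longrightarrow> j \<in> {1..fib (n + 1)} \<Longrightarrow>
           cauchy_distributed (given M (\<lambda>\<omega>. N t \<omega> = n)) (Y j n) 0 (1 / real (fib n))"
  shows "eq_in_distribution M
           (\<lambda>\<omega>. if N t \<omega> = 0 then c
                 else contfrac (map (\<lambda>j. X j \<omega>) [1..<N t \<omega> + 1]))
           (\<lambda>\<omega>. if N t \<omega> = 0 then c
                 else \<Sum>j = 1..fib (N t \<omega> + 1). Y j (N t \<omega>) \<omega>)"
proof -
  interpret prob_space M by fact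
  have N [measurable]: "N t \<in> measurable M (count_space UNIV)"
    using assms(5) \<open>0 < t\<close> by (auto simp: poisson_process_def)
  have X [measurable]: "X j \<in> borel_measurable M" if "1 \<le> j" for j
    using assms(3)[OF that] by (auto simp: cauchy_distributed_def distributed_def)
  \<comment> \<open>The conditional measure has the same measurable sets as \<open>M\<close>, so
    measurability carries over.\<close>
  have Y [measurable]: "Y j n \<in> borel_measurable M" if "1 \<le> n" "j \<in> {1..fib (n + 1)}" for j n
    using assms(9)[OF that] by (auto simp: cauchy_distributed_def distributed_def cong: measurable_cong_sets)
  \<comment> \<open>As a function of a whole sequence, \<open>C n\<close> can be evaluated at the
    random levels and at points of the product space.\<close>
  define C where "C n f = contfrac (map f [1..<n + 1])" for n and f :: "nat \<Rightarrow> real"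
  define U where "U n \<omega> = (if n = 0 then c else C n (\<lambda>j. X j \<omega>))" for n \<omega>
  define V where "V n \<omega> = (if n = 0 then c else \<Sum>j = 1..fib (n + 1). Y j n \<omega>)" for n \<omega>
  have U_meas [measurable]: "U n \<in> borel_measurable M" for n
    unfolding U_def C_def by (cases n) (auto intro!: measurable_contfrac X simp del: upt_Suc)
  have V_meas [measurable]: "V n \<in> borel_measurable M" for n
    unfolding V_def by (cases n) (auto intro!: borel_measurable_sum Y)

  have "emeasure M {\<omega>\<in>space M. N t \<omega> = n \<and> U n \<omega> \<in> A}
      = emeasure M {\<omega>\<in>space M. N t \<omega> = n \<and> V n \<omega> \<in> A}" if A [measurable]: "A \<in> sets borel" for n A
  \<comment> \<open>For \<open>n = 0\<close> both variables equal \<open>c\<close>, and on a null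
    event both sides vanish. In the remaining case the conditional measure is a probability
    measure.\<close>
  proof (cases "n = 0 \<or> emeasure M {\<omega>\<in>space M. N t \<omega> = n} = 0")
    case True
    then show ?thesis
    proof
      assume null: "emeasure M {\<omega>\<in>space M. N t \<omega> = n} = 0"
      have "emeasure M {\<omega>\<in>space M. N t \<omega> = n \<and> W \<omega>} = 0" for W
        using emeasure_mono[of "{\<omega>\<in>space M. N t \<omega> = n \<and> W \<omega>}" "{\<omega>\<in>space M. N t \<omega> = n}" M] null
        by auto
      then show ?thesis by simp
    qed (simp add: U_def V_def)
  next
    case False
    then have n: "1 \<le> n" and pos: "emeasure M {\<omega>\<in>space M. N t \<omega> = n} \<noteq> 0" by auto
    define G where "G = given M (\<lambda>\<omega>. N t \<omega> = n)"
    interpret G: prob_space G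
      unfolding G_def using pos by (intro prob_space_uniform_measure) auto
    have [measurable_cong]: "sets G = sets M" and space_G: "space G = space M" by (simp_all add: G_def)
    \<comment> \<open>\<open>?K\<close> is the law of \<open>U n\<close> under \<open>M\<close> and
      also the law of \<open>V n\<close> under the conditional measure \<open>G\<close>, as a sum of
      \<open>fib (n + 1)\<close> variables of scale \<open>1 / real (fib n)\<close>.\<close>
    let ?s = "real (fib (n + 1)) / real (fib n)"
    let ?K = "density lborel (\<lambda>x. ennreal (cauchy_density 0 ?s x))"

    have "cauchy_distributed M (\<lambda>\<omega>. C n (\<lambda>j. X j \<omega>)) 0 ?s"
      unfolding C_def using cauchy_distributed_contfrac[OF assms(2,3), of "[1..<n + 1]"] n
      by (simp add: subset_iff del: upt_Suc)
    then have U: "distr M lborel (U n) = ?K"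
      using n by (simp add: U_def[abs_def] cauchy_distributed_def distributed_def)
    have "cauchy_distributed G (\<lambda>\<omega>. \<Sum>j = 1..fib (n + 1). Y j n \<omega>) 0
        (real (card {1..fib (n + 1)}) * (1 / real (fib n)))"
      using assms(8,9)[OF n] fib_neq_0_nat[of "n + 1"] unfolding G_def[symmetric]
      by (intro G.cauchy_distributed_sum) auto
    then have V: "distr G lborel (V n) = ?K"
      using n by (simp add: V_def[abs_def] cauchy_distributed_def distributed_def)

    \<comment> \<open>Independence is given for the families as a whole, so the events about
      \<open>U n\<close> and \<open>N t\<close> are written as preimages of sets \<open>S\<close>
      and \<open>T\<close> in the product spaces.\<close>
    define S where "S = {f \<in> space (PiM {1..} (\<lambda>_. borel)). C n f \<in> A}"
    define T where "T = {f \<in> space (PiM {0::real..} (\<lambda>_. count_space (UNIV::nat set))). f t = n}"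
    have "C n \<in> borel_measurable (PiM {1..} (\<lambda>_. borel))"
      unfolding C_def using n
      by (intro measurable_contfrac measurable_component_singleton) auto
    then have S: "S \<in> sets (PiM {1..} (\<lambda>_. borel))"
      unfolding S_def by measurable
    have "(\<lambda>f. f t) \<in> measurable (PiM {0::real..} (\<lambda>_. count_space (UNIV::nat set))) (count_space UNIV)"
      using \<open>0 < t\<close> by (intro measurable_component_singleton) auto
    then have T: "T \<in> sets (PiM {0::real..} (\<lambda>_. count_space (UNIV::nat set)))"
      unfolding T_def by measurable
    \<comment> \<open>Only the coordinates 1, ..., n enter \<open>C n\<close>, and all of them
      survive the restriction.\<close>
    have C_restrict: "C n (\<lambda>i\<in>{1..}. f i) = C n f" for f
      unfolding C_def by (auto intro!: arg_cong[where f=contfrac])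
    have XS: "(\<lambda>\<omega>. \<lambda>i\<in>{1..}. X i \<omega>) -` S \<inter> space M = {\<omega>\<in>space M. U n \<omega> \<in> A}"
      using n by (auto simp: S_def U_def C_restrict[unfolded One_nat_def] space_PiM)
    have NT: "(\<lambda>\<omega>. \<lambda>s\<in>{0..}. N s \<omega>) -` T \<inter> space M = {\<omega>\<in>space M. N t \<omega> = n}"
      using \<open>0 < t\<close> by (auto simp: T_def space_PiM)
    have "prob ({\<omega>\<in>space M. U n \<omega> \<in> A} \<inter> {\<omega>\<in>space M. N t \<omega> = n})
        = prob {\<omega>\<in>space M. U n \<omega> \<in> A} * prob {\<omega>\<in>space M. N t \<omega> = n}"
      using assms(6) S T unfolding indep_families_def XS[symmetric] NT[symmetric]
      by (rule_tac indep_setD) auto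
    moreover have "{\<omega>\<in>space M. U n \<omega> \<in> A} \<inter> {\<omega>\<in>space M. N t \<omega> = n}
        = {\<omega>\<in>space M. N t \<omega> = n \<and> U n \<omega> \<in> A}" by auto
    ultimately have "emeasure M {\<omega>\<in>space M. N t \<omega> = n \<and> U n \<omega> \<in> A}
        = emeasure M {\<omega>\<in>space M. U n \<omega> \<in> A} * emeasure M {\<omega>\<in>space M. N t \<omega> = n}"
      by (simp add: emeasure_eq_measure ennreal_mult)
    \<comment> \<open>Independence has left the unconditional law of \<open>U n\<close>, which is
      now replaced by the conditional law of \<open>V n\<close> through the common
      \<open>?K\<close>.\<close>
    also have "emeasure M {\<omega>\<in>space M. U n \<omega> \<in> A} = emeasure ?K A"
      unfolding U[symmetric] by (subst emeasure_distr) (auto intro!: arg_cong[where f="emeasure M"])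
    also have "\<dots> = emeasure G {\<omega>\<in>space M. V n \<omega> \<in> A}"
      unfolding V[symmetric]
      by (subst emeasure_distr) (auto simp: space_G intro!: arg_cong[where f="emeasure G"])
    also have "\<dots> = emeasure M ({\<omega>\<in>space M. N t \<omega> = n} \<inter> {\<omega>\<in>space M. V n \<omega> \<in> A})
        / emeasure M {\<omega>\<in>space M. N t \<omega> = n}"
      unfolding G_def by (rule emeasure_uniform_measure) measurable
    \<comment> \<open>Multiplying by the probability of the condition undoes the conditioning. The
      cancellation in \<open>ennreal\<close> is valid because this probability is nonzero and
      finite.\<close>
    also have "\<dots> * emeasure M {\<omega>\<in>space M. N t \<omega> = n}
        = emeasure M ({\<omega>\<in>space M. N t \<omega> = n} \<inter> {\<omega>\<in>space M. V n \<omega> \<in> A})"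
      using pos by (simp add: ennreal_divide_times ennreal_divide_self less_top[symmetric])
    also have "{\<omega>\<in>space M. N t \<omega> = n} \<inter> {\<omega>\<in>space M. V n \<omega> \<in> A}
        = {\<omega>\<in>space M. N t \<omega> = n \<and> V n \<omega> \<in> A}" by auto
    finally show ?thesis .
  qed
  then have "distr M borel (\<lambda>\<omega>. U (N t \<omega>) \<omega>) = distr M borel (\<lambda>\<omega>. V (N t \<omega>) \<omega>)"
    by (intro distr_mixture_cong) measurable
  then have "eq_in_distribution M (\<lambda>\<omega>. U (N t \<omega>) \<omega>) (\<lambda>\<omega>. V (N t \<omega>) \<omega>)"
    by (auto simp: eq_in_distribution_def)
  then show ?thesis unfolding U_def V_def C_def .
qed

end
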